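(* Let $\mathbf w=(w_1,\dots,w_n)\in\mathcal S_n$, $\pi\in\mathcal P(\mathcal X)$, $P_1,\dots,P_n,Q\in\mathcal L(\mathcal X)$, where every $P_i$ is $\pi$-stationary. Let $S_1,\dots,S_m$ be mutually disjoint sets with $\bigsqcup_{j=1}^m S_j=[d]$. Then, with $\overline P=\sum_{i=1}^n w_iP_i$, $$\sum_{i=1}^n w_i D_{\mathrm{KL}}^{\pi}\big(P_i\,\|\,\otimes_{j=1}^m Q^{(S_j)}\big)=\sum_{i=1}^n w_i D_{\mathrm{KL}}^{\pi}\big(P_i\,\|\,\otimes_{j=1}^m \overline P^{(S_j)}\big)+\sum_{j=1}^m D_{\mathrm{KL}}^{\pi^{(S_j)}}\big(\overline P^{(S_j)}\,\|\,Q^{(S_j)}\big).$$ In particular, $$\min_{Q\in\mathcal L(\mathcal X);\ Q=\otimes_{j=1}^m Q^{(S_j)}}\ \sum_{i=1}^n w_iD_{\mathrm{KL}}^{\pi}(P_i\,\|\,Q)=\sum_{i=1}^n w_iD_{\mathrm{KL}}^{\pi}\big(P_i\,\|\,\otimes_{j=1}^m\overline P^{(S_j)}\big).$$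
   Context: $[d]=\{1,\dots,d\}$; $\mathcal X=\mathcal X^{(1)}\times\cdots\times\mathcal X^{(d)}$ is a finite product state space; for $S\subseteq[d]$, $\mathcal X^{(S)}=\times_{i\in S}\mathcal X^{(i)}$, and $-S$ denotes $[d]\setminus S$. $\mathcal L(\mathcal Y)$ is the set of transition (row-stochastic) matrices on a finite set $\mathcal Y$. $\mathcal P(\mathcal X)$ is the set of probability mass functions on $\mathcal X$ with $\min_x\pi(x)>0$. $P\in\mathcal L(\mathcal X)$ is $\pi$-stationary if $\pi P=\pi$. $\mathcal S_n=\{\mathbf w\in\mathbb R_+^n:\sum_i w_i=1\}$ (weights may be $0$). For $P\in\mathcal L(\mathcal X)$ and $S\subseteq[d]$, the keep-$S$-in matrix $P^{(S)}\in\mathcal L(\mathcal X^{(S)})$ (with respect to $\pi$) is $$P^{(S)}(x^{(S)},y^{(S)})=\frac{\sum_{x^{(-S)},y^{(-S)}}\pi(x)P(x,y)}{\sum_{x^{(-S)}}\pi(x)},$$ with the convention $P^{(\emptyset)}=1$. $\pi^{(S)}$ is the marginal of $\pi$ on $\mathcal X^{(S)}$. For a partition $(S_1,\dots,S_m)$ of $[d]$ and $M_j\in\mathcal L(\mathcal X^{(S_j)})$, $(\otimes_{j=1}^mM_j)(x,y)=\prod_{j=1}^mM_j(x^{(S_j)},y^{(S_j)})$. For a probability mass $\pi$ and transition matrices $M,L$ on the same space, $D_{\mathrm{KL}}^{\pi}(M\|L)=\sum_x\pi(x)\sum_yM(x,y)\ln\frac{M(x,y)}{L(x,y)}$, with $0\ln\frac0a:=0$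 for $a\in[0,1]$, $b\ln\frac b0:=+\infty$ for $b>0$, and $0\cdot\infty:=0$. *)

theory Defs
  imports Complex_Main "HOL-Library.Extended_Real" "HOL-Library.FuncSet" "HOL-Library.Disjoint_Sets"
begin

text \<open>
  The coordinate spaces are finite sets \<open>X i\<close> for \<open>i \<in> {1..d}\<close>, all of one element type. For
  \<open>S \<subseteq> {1..d}\<close> the product over \<open>S\<close> is \<open>PiE S X\<close>, and the subvector of \<open>x\<close> with coordinates in
  \<open>S\<close> is \<open>restrict x S\<close>. Matrices and mass functions are real-valued functions of which only the
  values on the relevant carrier matter.
\<close>

definition transition_matrices :: "'s set \<Rightarrow> ('s \<Rightarrow> 's \<Rightarrow> real) set" where
  "transition_matrices Y =
     {M. (\<forall>x\<in>Y. \<forall>y\<in>Y. 0 \<le> M x y) \<and> (\<forall>x\<in>Y. (\<Sum>y\<in>Y. M x y) = 1)}"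

definition positive_mass_functions :: "'s set \<Rightarrow> ('s \<Rightarrow> real) set" where
  "positive_mass_functions Y = {p. (\<forall>x\<in>Y. 0 < p x) \<and> (\<Sum>x\<in>Y. p x) = 1}"

definition stationary :: "'s set \<Rightarrow> ('s \<Rightarrow> real) \<Rightarrow> ('s \<Rightarrow> 's \<Rightarrow> real) \<Rightarrow> bool" where
  "stationary Y p M \<longleftrightarrow> (\<forall>y\<in>Y. (\<Sum>x\<in>Y. p x * M x y) = p y)"

definition weights :: "nat \<Rightarrow> (nat \<Rightarrow> real) set" where
  "weights n = {w. (\<forall>i\<in>{1..n}. 0 \<le> w i) \<and> (\<Sum>i=1..n. w i) = 1}"

definition weighted_mean ::
    "nat \<Rightarrow> (nat \<Rightarrow> real) \<Rightarrow> (nat \<Rightarrow> 's \<Rightarrow> 's \<Rightarrow> real) \<Rightarrow> 's \<Rightarrow> 's \<Rightarrow> real" where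
  "weighted_mean n w P x y = (\<Sum>i=1..n. w i * P i x y)"

text \<open>
  Summing over the coordinates outside \<open>S\<close>, with the coordinates in \<open>S\<close> held at \<open>u\<close>, is summing
  over the following fiber.
\<close>

definition fiber :: "nat \<Rightarrow> (nat \<Rightarrow> 'a set) \<Rightarrow> nat set \<Rightarrow> (nat \<Rightarrow> 'a) \<Rightarrow> (nat \<Rightarrow> 'a) set" where
  "fiber d X S u = {x \<in> PiE {1..d} X. restrict x S = u}"

definition marginal ::
    "nat \<Rightarrow> (nat \<Rightarrow> 'a set) \<Rightarrow> ((nat \<Rightarrow> 'a) \<Rightarrow> real) \<Rightarrow> nat set \<Rightarrow> (nat \<Rightarrow> 'a) \<Rightarrow> real" where
  "marginal d X p S u = (\<Sum>x\<in>fiber d X S u. p x)"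

text \<open>
  For \<open>S = {}\<close> the carrier \<open>PiE {} X\<close> is a singleton whose fiber is the whole space, so for a
  transition matrix \<open>P\<close> the quotient is the \<open>1 \<times> 1\<close> matrix with entry \<open>1\<close>.
\<close>

definition keep_in ::
    "nat \<Rightarrow> (nat \<Rightarrow> 'a set) \<Rightarrow> ((nat \<Rightarrow> 'a) \<Rightarrow> real) \<Rightarrow> nat set
      \<Rightarrow> ((nat \<Rightarrow> 'a) \<Rightarrow> (nat \<Rightarrow> 'a) \<Rightarrow> real) \<Rightarrow> (nat \<Rightarrow> 'a) \<Rightarrow> (nat \<Rightarrow> 'a) \<Rightarrow> real" where
  "keep_in d X p S P u v =
     (\<Sum>x\<in>fiber d X S u. \<Sum>y\<in>fiber d X S v. p x * P x y) / (\<Sum>x\<in>fiber d X S u. p x)"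

definition tensor ::
    "nat \<Rightarrow> (nat \<Rightarrow> nat set) \<Rightarrow> (nat \<Rightarrow> (nat \<Rightarrow> 'a) \<Rightarrow> (nat \<Rightarrow> 'a) \<Rightarrow> real)
      \<Rightarrow> (nat \<Rightarrow> 'a) \<Rightarrow> (nat \<Rightarrow> 'a) \<Rightarrow> real" where
  "tensor m S M x y = (\<Prod>j=1..m. M j (restrict x (S j)) (restrict y (S j)))"

text \<open>
  The summand \<open>a ln (a / b)\<close> with its conventions; they are spelled out because \<open>a / 0 = 0\<close>
  in \<^typ>\<open>real\<close>. The convention \<open>0 \<cdot> \<infinity> = 0\<close> is that of \<^typ>\<open>ereal\<close>.
\<close>

definition KL_term :: "real \<Rightarrow> real \<Rightarrow> ereal" where
  "KL_term a b = (if a = 0 then 0 else if b = 0 then \<infinity> else ereal (a * ln (a / b)))"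

definition KL ::
    "'s set \<Rightarrow> ('s \<Rightarrow> real) \<Rightarrow> ('s \<Rightarrow> 's \<Rightarrow> real) \<Rightarrow> ('s \<Rightarrow> 's \<Rightarrow> real) \<Rightarrow> ereal" where
  "KL Y p M L = (\<Sum>x\<in>Y. ereal (p x) * (\<Sum>y\<in>Y. KL_term (M x y) (L x y)))"

text \<open>
  Matrices \<open>Q\<close> with \<open>Q = \<Otimes>\<^sub>j Q\<^bsup>(S\<^sub>j)\<^esup>\<close>, equality being equality of entries.
\<close>

definition factorizable ::
    "nat \<Rightarrow> (nat \<Rightarrow> 'a set) \<Rightarrow> ((nat \<Rightarrow> 'a) \<Rightarrow> real) \<Rightarrow> nat \<Rightarrow> (nat \<Rightarrow> nat set)
      \<Rightarrow> ((nat \<Rightarrow> 'a) \<Rightarrow> (nat \<Rightarrow> 'a) \<Rightarrow> real) set" where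
  "factorizable d X p m S =
     {Q \<in> transition_matrices (PiE {1..d} X).
        \<forall>x\<in>PiE {1..d} X. \<forall>y\<in>PiE {1..d} X. Q x y = tensor m S (\<lambda>j. keep_in d X p (S j) Q) x y}"

text \<open>
  The minimum is attained and equals \<open>v\<close>. (\<^const>\<open>Min\<close> is only meaningful for finite sets.)
\<close>

definition is_minimum_over :: "('b \<Rightarrow> 'c::order) \<Rightarrow> 'b set \<Rightarrow> 'c \<Rightarrow> bool" where
  "is_minimum_over f A v \<longleftrightarrow> (\<exists>a\<in>A. f a = v) \<and> (\<forall>a\<in>A. v \<le> f a)"

end

theory Submission imports Defs begin

text \<open>
  Write \<open>p\<^sub>j\<close> and \<open>q\<^sub>j\<close> for the matrices \<open>keep_in\<close> of the weighted mean and of \<open>Q\<close> on the block \<open>S j\<close>.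
  The logarithm turns a quotient of tensor products into a sum: replacing \<open>\<Otimes>\<^sub>j q\<^sub>j\<close> by \<open>\<Otimes>\<^sub>j p\<^sub>j\<close> inside the
  divergence from \<open>P i\<close> changes it by the sum over \<open>j\<close> of the \<open>\<pi> x * P i x y\<close> averages of
  \<open>ln (p\<^sub>j / q\<^sub>j)\<close>. This correction is linear in \<open>P i\<close>, so averaging over \<open>i\<close> replaces \<open>P i\<close> by the
  weighted mean; and it depends on \<open>x\<close> and \<open>y\<close> only through their coordinates in \<open>S j\<close>, so the law
  \<open>\<pi> x * weighted_mean n w P x y\<close> of a pair of states can be summed over fibers. By the definition of
  \<open>keep_in\<close> the summed law is \<open>marginal * p\<^sub>j\<close>, and the correction becomes the divergence of \<open>p\<^sub>j\<close>
  from \<open>q\<^sub>j\<close>. The two halves are \<open>weighted_KL_tensor_chain\<close> and \<open>KL_keep_in_eq_sum\<close>.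

  Infinite values need no case distinction on the level of the theorem. The weights and the masses are
  finite and nonnegative, and for such factors multiplication in \<^typ>\<open>ereal\<close> is distributive without
  restriction, so all sums can be rearranged in \<^typ>\<open>ereal\<close>. What has to be excluded is that
  \<open>p\<^sub>j\<close> vanishes where \<open>P i\<close> does not; this holds whenever \<open>w i \<noteq> 0\<close>, since a positive transition
  probability of the mean gives positive probability to the transition between the projected
  states (\<open>keep_in_restrict_pos\<close>).

  For the minimum, a factorizable \<open>Q\<close> may be replaced by \<open>\<Otimes>\<^sub>j q\<^sub>j\<close>, and the divergences added in the
  identity are nonnegative (\<open>KL_nonneg\<close>). The bound is attained at \<open>\<Otimes>\<^sub>j p\<^sub>j\<close>, because a tensor product of
  transition matrices has its own factors as \<open>keep_in\<close> matrices (\<open>keep_in_tensor\<close>).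
\<close>

section \<open>Divergence terms in the extended reals\<close>

text \<open>
  Splitting \<^const>\<open>KL_term\<close> as a mass times a log ratio separates the part in which the divergence is
  linear. For \<open>a = 0\<close> the value is arbitrary: it only ever occurs with the factor \<open>0\<close>.
\<close>

definition log_ratio :: "real \<Rightarrow> real \<Rightarrow> ereal" where
  "log_ratio a b = (if b = 0 then \<infinity> else ereal (ln (a / b)))"

lemma KL_term_eq_mult_log_ratio:
  assumes "0 \<le> a"
  shows "KL_term a b = ereal a * log_ratio a b"
  using assms by (auto simp: KL_term_def log_ratio_def)

text \<open>
  With summands of both signs and possibly infinite, distributivity still holds because the factor is
  finite; in the next lemma it holds because the real factors have the same sign.
\<close>

lemma ereal_mult_sum:
  assumes "0 \<le> c"
  shows "ereal c * (\<Sum>i\<in>I. f i) = (\<Sum>i\<in>I. ereal c * f i)"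
proof (induction I rule: infinite_finite_induct)
  case (insert i I)
  then show ?case using assms by (simp add: ereal_pos_distrib)
qed auto

lemma sum_mult_ereal:
  assumes "\<And>i. i \<in> I \<Longrightarrow> 0 \<le> a i"
  shows "ereal (\<Sum>i\<in>I. a i) * c = (\<Sum>i\<in>I. ereal (a i) * c)"
  using assms
proof (induction I rule: infinite_finite_induct)
  case (insert i I)
  have "ereal (\<Sum>i\<in>insert i I. a i) * c = (ereal (a i) + ereal (\<Sum>i\<in>I. a i)) * c"
    using insert by simp
  also have "\<dots> = ereal (a i) * c + ereal (\<Sum>i\<in>I. a i) * c"
    using insert by (intro ereal_left_distrib) (auto intro: sum_nonneg)
  finally show ?case using insert by simp
qed auto

text \<open>
  The chain rule behind the theorem. The numbers \<open>p j\<close> must be positive where \<open>a > 0\<close>: then the first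
  term on the right is finite, and both sides are infinite exactly if some \<open>q j\<close> vanishes.
\<close>

lemma KL_term_prod_chain:
  assumes "finite J" "0 \<le> a"
    and q: "\<And>j. j \<in> J \<Longrightarrow> 0 \<le> q j"
    and p: "\<And>j. a \<noteq> 0 \<Longrightarrow> j \<in> J \<Longrightarrow> 0 < p j"
  shows "KL_term a (\<Prod>j\<in>J. q j)
           = KL_term a (\<Prod>j\<in>J. p j) + (\<Sum>j\<in>J. ereal a * log_ratio (p j) (q j))"
proof (cases "a = 0")
  case True
  then show ?thesis by (simp add: KL_term_def zero_ereal_def[symmetric])
next
  case False
  with assms have a: "a > 0" by simp
  have p_pos: "(\<Prod>j\<in>J. p j) > 0" using p False by (simp add: prod_pos)
  show ?thesis
  proof (cases "\<exists>j\<in>J. q j = 0")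
    case True
    then obtain k where k: "k \<in> J" "q k = 0" by auto
    then have prod0: "(\<Prod>j\<in>J. q j) = 0" using \<open>finite J\<close> by auto
    have "(\<Sum>j\<in>J. ereal a * log_ratio (p j) (q j)) = \<infinity>"
      using k a \<open>finite J\<close> by (subst sum_Pinfty) (auto simp: log_ratio_def)
    then show ?thesis using prod0 p_pos a by (simp add: KL_term_def)
  next
    case nz: False
    with q have q_pos: "0 < q j" if "j \<in> J" for j using that by (metis less_eq_real_def)
    have pq_ne: "p j \<noteq> 0" "q j \<noteq> 0" if "j \<in> J" for j
      using p[OF False that] q_pos[OF that] by auto
    have qq: "(\<Prod>j\<in>J. q j) > 0" using q_pos by (simp add: prod_pos)
    have "(\<Sum>j\<in>J. ereal a * log_ratio (p j) (q j))
        = (\<Sum>j\<in>J. ereal (a * (ln (p j) - ln (q j))))"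
      using pq_ne
      by (intro sum.cong refl) (auto simp: log_ratio_def ln_div)
    also have "\<dots> = ereal (a * (ln (\<Prod>j\<in>J. p j) - ln (\<Prod>j\<in>J. q j)))"
      using pq_ne \<open>finite J\<close>
      by (simp add: ln_prod sum_distrib_left[symmetric] sum_subtractf)
    finally show ?thesis using a p_pos qq
      by (simp add: KL_term_def ln_div algebra_simps)
  qed
qed

lemma KL_eq_sum_log_ratio:
  assumes "\<And>x. x \<in> Y \<Longrightarrow> 0 \<le> p x" "\<And>x y. x \<in> Y \<Longrightarrow> y \<in> Y \<Longrightarrow> 0 \<le> M x y"
  shows "KL Y p M L = (\<Sum>x\<in>Y. \<Sum>y\<in>Y. ereal (p x * M x y) * log_ratio (M x y) (L x y))"
  unfolding KL_def using assms
  by (intro sum.cong refl)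
    (simp add: KL_term_eq_mult_log_ratio ereal_mult_sum mult.assoc[symmetric])

text \<open>
  This is \<open>ln t \<le> t - 1\<close> at \<open>t = b / a\<close>. Summed over a row of two transition matrices the lower bound
  is \<open>1 - 1\<close>, which gives Gibbs' inequality below, separately for each row.
\<close>

lemma KL_term_ge_diff:
  assumes "0 \<le> a" "0 \<le> b"
  shows "ereal (a - b) \<le> KL_term a b"
proof -
  have "a - b \<le> a * ln (a / b)" if ab: "0 < a" "0 < b"
  proof -
    have "ln (b / a) \<le> b / a - 1" using ab by (intro ln_le_minus_one) simp
    then have "a * ln (b / a) \<le> a * (b / a - 1)" using ab by (intro mult_left_mono) auto
    then show ?thesis using ab by (simp add: ln_div right_diff_distrib)
  qed
  then show ?thesis using assms by (auto simp: KL_term_def)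
qed

lemma KL_nonneg:
  assumes "\<And>x. x \<in> Y \<Longrightarrow> 0 \<le> p x"
    and M: "M \<in> transition_matrices Y" and L: "L \<in> transition_matrices Y"
  shows "0 \<le> KL Y p M L"
  unfolding KL_def
proof (rule sum_nonneg)
  fix x assume x: "x \<in> Y"
  have "0 = ereal (\<Sum>y\<in>Y. M x y - L x y)"
    using x M L by (simp add: transition_matrices_def sum_subtractf)
  also have "\<dots> = (\<Sum>y\<in>Y. ereal (M x y - L x y))" by simp
  also have "\<dots> \<le> (\<Sum>y\<in>Y. KL_term (M x y) (L x y))"
    using x M L by (intro sum_mono KL_term_ge_diff) (auto simp: transition_matrices_def)
  finally have "0 \<le> (\<Sum>y\<in>Y. KL_term (M x y) (L x y))" .
  then show "0 \<le> ereal (p x) * (\<Sum>y\<in>Y. KL_term (M x y) (L x y))"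
    using assms(1)[OF x] by (intro ereal_0_le_mult) auto
qed

section \<open>The chain rule for mixtures\<close>

lemma weighted_mean_transition_matrix:
  assumes w: "w \<in> weights n"
    and P: "\<And>i. i \<in> {1..n} \<Longrightarrow> P i \<in> transition_matrices Y"
  shows "weighted_mean n w P \<in> transition_matrices Y"
proof -
  have "(\<Sum>y\<in>Y. weighted_mean n w P x y) = 1" if x: "x \<in> Y" for x
  proof -
    have "(\<Sum>y\<in>Y. weighted_mean n w P x y) = (\<Sum>i=1..n. w i * (\<Sum>y\<in>Y. P i x y))"
      unfolding weighted_mean_def by (subst sum.swap) (simp add: sum_distrib_left)
    also have "\<dots> = (\<Sum>i=1..n. w i)"
      using P x by (intro sum.cong refl) (simp add: transition_matrices_def)
    finally show ?thesis using w by (simp add: weights_def)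
  qed
  moreover have "0 \<le> weighted_mean n w P x y" if "x \<in> Y" "y \<in> Y" for x y
    unfolding weighted_mean_def using w P that
    by (intro sum_nonneg mult_nonneg_nonneg) (auto simp: weights_def transition_matrices_def)
  ultimately show ?thesis by (auto simp: transition_matrices_def)
qed

text \<open>
  The correction terms on the right are linear in \<open>P i\<close> with log ratios that do not depend on \<open>i\<close>;
  hence only the weighted mean enters them. The condition on \<open>M\<close> is absolute continuity of the mean
  with respect to each factor, and it passes to every \<open>P i\<close> of positive weight.
\<close>

lemma weighted_KL_tensor_chain:
  fixes Y :: "(nat \<Rightarrow> 'a) set"
  assumes w: "w \<in> weights n"
    and \<pi>: "\<And>x. x \<in> Y \<Longrightarrow> 0 \<le> \<pi> x"
    and P: "\<And>i. i \<in> {1..n} \<Longrightarrow> P i \<in> transition_matrices Y"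
    and N: "\<And>j x y. j \<in> {1..m} \<Longrightarrow> x \<in> Y \<Longrightarrow> y \<in> Y \<Longrightarrow>
              0 \<le> N j (restrict x (S j)) (restrict y (S j))"
    and M: "\<And>j x y. j \<in> {1..m} \<Longrightarrow> x \<in> Y \<Longrightarrow> y \<in> Y \<Longrightarrow> weighted_mean n w P x y \<noteq> 0 \<Longrightarrow>
              0 < M j (restrict x (S j)) (restrict y (S j))"
  shows "(\<Sum>i=1..n. ereal (w i) * KL Y \<pi> (P i) (tensor m S N))
       = (\<Sum>i=1..n. ereal (w i) * KL Y \<pi> (P i) (tensor m S M))
         + (\<Sum>j=1..m. \<Sum>x\<in>Y. \<Sum>y\<in>Y. ereal (\<pi> x * weighted_mean n w P x y) *
              log_ratio (M j (restrict x (S j)) (restrict y (S j)))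
                        (N j (restrict x (S j)) (restrict y (S j))))"
proof -
  define R where "R j x y = log_ratio (M j (restrict x (S j)) (restrict y (S j)))
                        (N j (restrict x (S j)) (restrict y (S j)))" for j x y
  have w0: "0 \<le> w i" if "i \<in> {1..n}" for i using w that by (auto simp: weights_def)
  have P0: "0 \<le> P i x y" if "i \<in> {1..n}" "x \<in> Y" "y \<in> Y" for i x y
    using P that by (auto simp: transition_matrices_def)
  have support: "weighted_mean n w P x y \<noteq> 0"
    if "i \<in> {1..n}" "x \<in> Y" "y \<in> Y" "w i \<noteq> 0" "P i x y \<noteq> 0" for i x y
    unfolding weighted_mean_def
    using that w0 P0 by (subst sum_nonneg_eq_0_iff) auto
  have step: "ereal (w i) * KL Y \<pi> (P i) (tensor m S N)
       = ereal (w i) * KL Y \<pi> (P i) (tensor m S M)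
         + (\<Sum>j=1..m. \<Sum>x\<in>Y. \<Sum>y\<in>Y. ereal (\<pi> x * (w i * P i x y)) * R j x y)"
    if i: "i \<in> {1..n}" for i
  \<comment> \<open>A matrix of weight zero need not be dominated by the mean, but it contributes zero to both
      sides.\<close>
  proof (cases "w i = 0")
    case True
    then show ?thesis by (simp add: zero_ereal_def[symmetric])
  next
    case False
    have chain: "KL_term (P i x y) (tensor m S N x y)
        = KL_term (P i x y) (tensor m S M x y) + (\<Sum>j=1..m. ereal (P i x y) * R j x y)"
      if "x \<in> Y" "y \<in> Y" for x y
      unfolding tensor_def R_def
      using that i False N M support P0 by (intro KL_term_prod_chain) auto
    have "KL Y \<pi> (P i) (tensor m S N)
        = (\<Sum>x\<in>Y. ereal (\<pi> x) * (\<Sum>y\<in>Y. KL_term (P i x y) (tensor m S M x y)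
             + (\<Sum>j=1..m. ereal (P i x y) * R j x y)))"
      unfolding KL_def using chain by simp
    also have "\<dots> = KL Y \<pi> (P i) (tensor m S M)
        + (\<Sum>x\<in>Y. \<Sum>y\<in>Y. \<Sum>j=1..m. ereal (\<pi> x * P i x y) * R j x y)"
      unfolding KL_def using \<pi>
      by (simp add: sum.distrib ereal_pos_distrib ereal_mult_sum mult.assoc[symmetric])
    finally have "ereal (w i) * KL Y \<pi> (P i) (tensor m S N)
        = ereal (w i) * KL Y \<pi> (P i) (tensor m S M)
         + (\<Sum>x\<in>Y. \<Sum>y\<in>Y. \<Sum>j=1..m. ereal (w i * (\<pi> x * P i x y)) * R j x y)"
      using w0[OF i] by (simp add: ereal_pos_distrib ereal_mult_sum mult.assoc[symmetric])
    also have "(\<Sum>x\<in>Y. \<Sum>y\<in>Y. \<Sum>j=1..m. ereal (w i * (\<pi> x * P i x y)) * R j x y)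
        = (\<Sum>j=1..m. \<Sum>x\<in>Y. \<Sum>y\<in>Y. ereal (\<pi> x * (w i * P i x y)) * R j x y)"
      by (simp only: sum.swap[where B = "{1..m}"] mult.left_commute)
    finally show ?thesis .
  qed
  have "(\<Sum>i=1..n. \<Sum>j=1..m. \<Sum>x\<in>Y. \<Sum>y\<in>Y. ereal (\<pi> x * (w i * P i x y)) * R j x y)
      = (\<Sum>j=1..m. \<Sum>x\<in>Y. \<Sum>y\<in>Y. \<Sum>i=1..n. ereal (\<pi> x * (w i * P i x y)) * R j x y)"
    by (subst sum.swap[where A = "{1..n}"], rule sum.cong[OF refl],
        subst sum.swap[where A = "{1..n}"], rule sum.cong[OF refl], rule sum.swap)
  also have "\<dots> = (\<Sum>j=1..m. \<Sum>x\<in>Y. \<Sum>y\<in>Y.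
      ereal (\<pi> x * weighted_mean n w P x y) * R j x y)"
    unfolding weighted_mean_def sum_distrib_left using w0 P0 \<pi>
    by (intro sum.cong refl sum_mult_ereal[symmetric]) auto
  finally show ?thesis using step by (simp add: sum.distrib R_def)
qed

section \<open>Projecting to a block of coordinates\<close>

lemma sum_over_fibers:
  assumes "finite (PiE {1..d} X)" "T \<subseteq> {1..d}" "finite (PiE T X)"
  shows "(\<Sum>u\<in>PiE T X. \<Sum>x\<in>fiber d X T u. g x) = (\<Sum>x\<in>PiE {1..d} X. g x)"
  unfolding fiber_def using assms
  by (intro sum.group) (auto simp: PiE_iff restrict_def)

lemma fiber_nonempty:
  assumes "PiE {1..d} X \<noteq> {}" "T \<subseteq> {1..d}" "u \<in> PiE T X"
  shows "fiber d X T u \<noteq> {}"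
proof -
  obtain z where z: "z \<in> PiE {1..d} X" using assms by auto
  have "(\<lambda>i. if i \<in> T then u i else z i) \<in> fiber d X T u"
    using assms z by (auto simp: fiber_def PiE_iff extensional_def restrict_def fun_eq_iff)
  then show ?thesis by auto
qed

lemma marginal_pos:
  assumes "finite (PiE {1..d} X)" "\<pi> \<in> positive_mass_functions (PiE {1..d} X)"
    and "T \<subseteq> {1..d}" "u \<in> PiE T X"
  shows "0 < marginal d X \<pi> T u"
  unfolding marginal_def
proof (rule sum_pos)
  have "PiE {1..d} X \<noteq> {}" using assms by (auto simp: positive_mass_functions_def)
  then show "fiber d X T u \<noteq> {}" using fiber_nonempty assms by blast
qed (use assms in \<open>auto simp: fiber_def positive_mass_functions_def\<close>)

text \<open>
  The law of the projected pair of states: \<open>keep_in\<close> is its conditional law given the first state.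
\<close>

lemma marginal_mult_keep_in:
  assumes "finite (PiE {1..d} X)" "\<pi> \<in> positive_mass_functions (PiE {1..d} X)"
    and "T \<subseteq> {1..d}" "u \<in> PiE T X"
  shows "marginal d X \<pi> T u * keep_in d X \<pi> T M u v
       = (\<Sum>x\<in>fiber d X T u. \<Sum>y\<in>fiber d X T v. \<pi> x * M x y)"
  using marginal_pos[OF assms] by (simp add: keep_in_def marginal_def)

lemma keep_in_transition_matrix:
  assumes fin: "finite (PiE {1..d} X)" and \<pi>: "\<pi> \<in> positive_mass_functions (PiE {1..d} X)"
    and T: "T \<subseteq> {1..d}" "finite (PiE T X)"
    and M: "M \<in> transition_matrices (PiE {1..d} X)"
  shows "keep_in d X \<pi> T M \<in> transition_matrices (PiE T X)"
proof -
  have "(\<Sum>v\<in>PiE T X. keep_in d X \<pi> T M u v) = 1" if u: "u \<in> PiE T X" for u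
  proof -
    have "marginal d X \<pi> T u * (\<Sum>v\<in>PiE T X. keep_in d X \<pi> T M u v)
        = (\<Sum>x\<in>fiber d X T u. \<Sum>v\<in>PiE T X. \<Sum>y\<in>fiber d X T v. \<pi> x * M x y)"
      by (simp add: sum_distrib_left marginal_mult_keep_in[OF fin \<pi> T(1) u])
        (rule sum.swap)
    also have "\<dots> = (\<Sum>x\<in>fiber d X T u. \<pi> x * (\<Sum>y\<in>PiE {1..d} X. M x y))"
      by (simp add: sum_over_fibers[OF fin T] sum_distrib_left)
    also have "\<dots> = marginal d X \<pi> T u"
      unfolding marginal_def using M
      by (intro sum.cong refl) (auto simp: transition_matrices_def fiber_def)
    finally show ?thesis using marginal_pos[OF fin \<pi> T(1) u] by simp
  qed
  moreover have "0 \<le> keep_in d X \<pi> T M u v" for u v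
    unfolding keep_in_def using \<pi> M
    by (intro divide_nonneg_nonneg sum_nonneg mult_nonneg_nonneg)
      (auto simp: transition_matrices_def fiber_def positive_mass_functions_def intro: less_imp_le)
  ultimately show ?thesis by (auto simp: transition_matrices_def)
qed

text \<open>
  A single pair \<open>(x, y)\<close> with \<open>M x y > 0\<close> already contributes the positive mass \<open>\<pi> x * M x y\<close> to the
  law of the projected pair.
\<close>

lemma keep_in_restrict_pos:
  assumes fin: "finite (PiE {1..d} X)" and \<pi>: "\<pi> \<in> positive_mass_functions (PiE {1..d} X)"
    and T: "T \<subseteq> {1..d}"
    and M: "M \<in> transition_matrices (PiE {1..d} X)"
    and x: "x \<in> PiE {1..d} X" and y: "y \<in> PiE {1..d} X" and nz: "M x y \<noteq> 0"
  shows "0 < keep_in d X \<pi> T M (restrict x T) (restrict y T)"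
proof -
  let ?u = "restrict x T" and ?v = "restrict y T"
  have u: "?u \<in> PiE T X" using x T by (auto simp: PiE_iff)
  have nonneg: "0 \<le> \<pi> a * M a b" if "a \<in> PiE {1..d} X" "b \<in> PiE {1..d} X" for a b
    using \<pi> M that
    by (intro mult_nonneg_nonneg)
      (auto simp: transition_matrices_def positive_mass_functions_def less_imp_le)
  have finf: "finite (fiber d X T a)" for a using fin by (simp add: fiber_def)
  have "0 < \<pi> x * M x y"
    using \<pi> M x y nz
    by (auto simp: transition_matrices_def positive_mass_functions_def less_le)
  also have "\<dots> \<le> (\<Sum>y\<in>fiber d X T ?v. \<pi> x * M x y)"
    using nonneg x y finf by (intro member_le_sum) (auto simp: fiber_def)
  also have "\<dots> \<le> (\<Sum>x\<in>fiber d X T ?u. \<Sum>y\<in>fiber d X T ?v. \<pi> x * M x y)"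
    using nonneg x y finf
    by (intro member_le_sum[where f = "\<lambda>x. \<Sum>y\<in>fiber d X T ?v. \<pi> x * M x y"])
      (auto simp: fiber_def intro!: sum_nonneg)
  also have "\<dots> = marginal d X \<pi> T ?u * keep_in d X \<pi> T M ?u ?v"
    using marginal_mult_keep_in[OF fin \<pi> T u] by simp
  finally show ?thesis
    using marginal_pos[OF fin \<pi> T u] by (simp add: zero_less_mult_iff)
qed

text \<open>
  Change of variables: the log ratio of the projected states may be averaged over pairs \<open>(x, y)\<close> or over
  pairs of projections, since the law of the latter is the image of the law of the former.
\<close>

lemma KL_keep_in_eq_sum:
  assumes fin: "finite (PiE {1..d} X)" and \<pi>: "\<pi> \<in> positive_mass_functions (PiE {1..d} X)"
    and T: "T \<subseteq> {1..d}" "finite (PiE T X)"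
    and M: "M \<in> transition_matrices (PiE {1..d} X)"
  shows "KL (PiE T X) (marginal d X \<pi> T) (keep_in d X \<pi> T M) L
       = (\<Sum>x\<in>PiE {1..d} X. \<Sum>y\<in>PiE {1..d} X. ereal (\<pi> x * M x y) *
            log_ratio (keep_in d X \<pi> T M (restrict x T) (restrict y T))
                      (L (restrict x T) (restrict y T)))"
proof -
  define R where "R u v = log_ratio (keep_in d X \<pi> T M u v) (L u v)" for u v
  have nonneg: "0 \<le> \<pi> a * M a b" if "a \<in> PiE {1..d} X" "b \<in> PiE {1..d} X" for a b
    using \<pi> M that
    by (intro mult_nonneg_nonneg)
      (auto simp: transition_matrices_def positive_mass_functions_def less_imp_le)
  have "KL (PiE T X) (marginal d X \<pi> T) (keep_in d X \<pi> T M) L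
      = (\<Sum>u\<in>PiE T X. \<Sum>v\<in>PiE T X.
           ereal (marginal d X \<pi> T u * keep_in d X \<pi> T M u v) * R u v)"
    unfolding R_def
    using keep_in_transition_matrix[OF assms] marginal_pos[OF fin \<pi> T(1)]
    by (intro KL_eq_sum_log_ratio) (auto simp: transition_matrices_def less_imp_le)
  also have "\<dots> = (\<Sum>u\<in>PiE T X. \<Sum>v\<in>PiE T X.
      \<Sum>x\<in>fiber d X T u. \<Sum>y\<in>fiber d X T v. ereal (\<pi> x * M x y) * R u v)"
  proof (intro sum.cong refl)
    fix u v assume u: "u \<in> PiE T X" and v: "v \<in> PiE T X"
    have "ereal (marginal d X \<pi> T u * keep_in d X \<pi> T M u v) * R u v
        = ereal (\<Sum>x\<in>fiber d X T u. \<Sum>y\<in>fiber d X T v. \<pi> x * M x y) * R u v"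
      by (simp only: marginal_mult_keep_in[OF fin \<pi> T(1) u])
    also have "\<dots> = (\<Sum>x\<in>fiber d X T u. ereal (\<Sum>y\<in>fiber d X T v. \<pi> x * M x y) * R u v)"
      using nonneg by (intro sum_mult_ereal sum_nonneg) (auto simp: fiber_def)
    also have "\<dots> = (\<Sum>x\<in>fiber d X T u. \<Sum>y\<in>fiber d X T v. ereal (\<pi> x * M x y) * R u v)"
      using nonneg by (intro sum.cong refl sum_mult_ereal) (auto simp: fiber_def)
    finally show "ereal (marginal d X \<pi> T u * keep_in d X \<pi> T M u v) * R u v = \<dots>" .
  qed
  also have "\<dots> = (\<Sum>u\<in>PiE T X. \<Sum>x\<in>fiber d X T u. \<Sum>v\<in>PiE T X. \<Sum>y\<in>fiber d X T v.
      ereal (\<pi> x * M x y) * R (restrict x T) (restrict y T))"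
  proof (rule sum.cong[OF refl])
    fix u
    show "(\<Sum>v\<in>PiE T X. \<Sum>x\<in>fiber d X T u. \<Sum>y\<in>fiber d X T v. ereal (\<pi> x * M x y) * R u v)
        = (\<Sum>x\<in>fiber d X T u. \<Sum>v\<in>PiE T X. \<Sum>y\<in>fiber d X T v.
             ereal (\<pi> x * M x y) * R (restrict x T) (restrict y T))"
      by (subst sum.swap, intro sum.cong refl) (simp add: fiber_def)
  qed
  also have "\<dots> = (\<Sum>x\<in>PiE {1..d} X. \<Sum>y\<in>PiE {1..d} X.
      ereal (\<pi> x * M x y) * R (restrict x T) (restrict y T))"
    by (simp only: sum_over_fibers[OF fin T])
  finally show ?thesis unfolding R_def .
qed

section \<open>Tensor products over a partition\<close>

lemma bij_betw_PiE_UNION: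
  assumes disj: "disjoint_family_on S J"
  shows "bij_betw (\<lambda>y. \<lambda>k\<in>J. restrict y (S k)) (PiE (\<Union>k\<in>J. S k) X) (PiE J (\<lambda>k. PiE (S k) X))"
proof -
  \<comment> \<open>The block containing \<open>i\<close>, which is unique by disjointness; the inverse map reads coordinate \<open>i\<close> off
      the component of that block.\<close>
  define b where "b i = (THE k. k \<in> J \<and> i \<in> S k)" for i
  have b: "b i = k" if "k \<in> J" "i \<in> S k" for i k
    unfolding b_def using disj that by (intro the_equality) (auto simp: disjoint_family_on_def)
  let ?U = "\<Union>k\<in>J. S k"
  show ?thesis
  proof (rule bij_betw_byWitness[where f' = "\<lambda>g. \<lambda>i\<in>?U. g (b i) i"])
    show "\<forall>y\<in>PiE ?U X. (\<lambda>i\<in>?U. (\<lambda>k\<in>J. restrict y (S k)) (b i) i) = y"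
    proof (intro ballI ext)
      fix y i assume y: "y \<in> PiE ?U X"
      show "(\<lambda>i\<in>?U. (\<lambda>k\<in>J. restrict y (S k)) (b i) i) i = y i"
      proof (cases "i \<in> ?U")
        case True
        then obtain k where "k \<in> J" "i \<in> S k" by blast
        with b[OF this] True show ?thesis by simp
      next
        case False
        with PiE_arb[OF y False] show ?thesis by (simp only: restrict_def if_False)
      qed
    qed
    show "\<forall>g\<in>PiE J (\<lambda>k. PiE (S k) X). (\<lambda>k\<in>J. restrict (\<lambda>i\<in>?U. g (b i) i) (S k)) = g"
    proof (intro ballI ext)
      fix g k i assume g: "g \<in> PiE J (\<lambda>k. PiE (S k) X)"
      show "(\<lambda>k\<in>J. restrict (\<lambda>i\<in>?U. g (b i) i) (S k)) k i = g k i"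
      proof (cases "k \<in> J")
        case k: True
        show ?thesis
        proof (cases "i \<in> S k")
          case True
          then have "i \<in> ?U" using k by blast
          then show ?thesis using k True b[OF k True] by simp
        next
          case False
          then show ?thesis using k PiE_arb[OF PiE_mem[OF g k] False] by simp
        qed
      next
        case False
        then show ?thesis using PiE_arb[OF g False] by simp
      qed
    qed
    show "(\<lambda>y. \<lambda>k\<in>J. restrict y (S k)) ` (PiE ?U X) \<subseteq> PiE J (\<lambda>k. PiE (S k) X)"
      by (auto simp: PiE_iff)
    show "(\<lambda>g. \<lambda>i\<in>?U. g (b i) i) ` (PiE J (\<lambda>k. PiE (S k) X)) \<subseteq> PiE ?U X"
      using b by (fastforce simp: PiE_iff)
  qed
qed

text \<open>
  A choice of a point is a choice of its restrictions to the blocks, made independently. This is the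
  distributive law that makes the rows of a tensor product sum to one.
\<close>

lemma sum_prod_blocks:
  fixes f :: "'j \<Rightarrow> ('i \<Rightarrow> 'a) \<Rightarrow> 'c::comm_semiring_1"
  assumes "finite J" "disjoint_family_on S J" "\<And>k. k \<in> J \<Longrightarrow> finite (PiE (S k) X)"
  shows "(\<Sum>y\<in>PiE (\<Union>k\<in>J. S k) X. \<Prod>k\<in>J. f k (restrict y (S k)))
       = (\<Prod>k\<in>J. \<Sum>u\<in>PiE (S k) X. f k u)"
proof -
  have "(\<Prod>k\<in>J. \<Sum>u\<in>PiE (S k) X. f k u)
      = (\<Sum>g\<in>PiE J (\<lambda>k. PiE (S k) X). \<Prod>k\<in>J. f k (g k))"
    using assms by (intro prod_sum_PiE)
  also have "\<dots> = (\<Sum>y\<in>PiE (\<Union>k\<in>J. S k) X. \<Prod>k\<in>J. f k ((\<lambda>k\<in>J. restrict y (S k)) k))"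
    by (rule sum.reindex_bij_betw[OF bij_betw_PiE_UNION[OF assms(2)], symmetric])
  finally show ?thesis by simp
qed

lemma tensor_transition_matrix:
  assumes disj: "disjoint_family_on S {1..m}" and un: "(\<Union>j\<in>{1..m}. S j) = {1..d}"
    and fin: "\<And>j. j \<in> {1..m} \<Longrightarrow> finite (PiE (S j) X)"
    and M: "\<And>j. j \<in> {1..m} \<Longrightarrow> M j \<in> transition_matrices (PiE (S j) X)"
  shows "tensor m S M \<in> transition_matrices (PiE {1..d} X)"
proof -
  have res: "restrict x (S j) \<in> PiE (S j) X" if "x \<in> PiE {1..d} X" "j \<in> {1..m}" for x j
    using that un by (auto simp: PiE_iff)
  have "(\<Sum>y\<in>PiE {1..d} X. tensor m S M x y) = 1" if x: "x \<in> PiE {1..d} X" for x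
  proof -
    have "(\<Sum>y\<in>PiE {1..d} X. tensor m S M x y)
        = (\<Prod>j=1..m. \<Sum>v\<in>PiE (S j) X. M j (restrict x (S j)) v)"
      unfolding tensor_def un[symmetric] using disj fin by (intro sum_prod_blocks) auto
    also have "\<dots> = 1"
      using M res[OF x] by (intro prod.neutral) (auto simp: transition_matrices_def)
    finally show ?thesis .
  qed
  moreover have "0 \<le> tensor m S M x y" if "x \<in> PiE {1..d} X" "y \<in> PiE {1..d} X" for x y
    unfolding tensor_def using M res that
    by (intro prod_nonneg) (auto simp: transition_matrices_def)
  ultimately show ?thesis by (auto simp: transition_matrices_def)
qed

text \<open>
  In a row of the tensor product the coordinates in the blocks other than \<open>S j\<close> sum to one, so summing
  over \<open>y\<close> with \<open>S j\<close>-coordinates \<open>v\<close> leaves \<open>M j u v\<close> for each \<open>x\<close> above \<open>u\<close>; the average over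
  such \<open>x\<close> with respect to \<open>\<pi>\<close> is then the same number.
\<close>

lemma keep_in_tensor:
  assumes finY: "finite (PiE {1..d} X)" and \<pi>: "\<pi> \<in> positive_mass_functions (PiE {1..d} X)"
    and disj: "disjoint_family_on S {1..m}" and un: "(\<Union>j\<in>{1..m}. S j) = {1..d}"
    and fin: "\<And>j. j \<in> {1..m} \<Longrightarrow> finite (PiE (S j) X)"
    and M: "\<And>j. j \<in> {1..m} \<Longrightarrow> M j \<in> transition_matrices (PiE (S j) X)"
    and j: "j \<in> {1..m}" and u: "u \<in> PiE (S j) X" and v: "v \<in> PiE (S j) X"
  shows "keep_in d X \<pi> (S j) (tensor m S M) u v = M j u v"
proof -
  have T: "S j \<subseteq> {1..d}" using un j by auto
  have row: "(\<Sum>y\<in>fiber d X (S j) v. tensor m S M x y) = M j u v"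
    if x: "x \<in> fiber d X (S j) u" for x
  proof -
    \<comment> \<open>The restriction to the fiber over \<open>v\<close> is moved into the \<open>j\<close>-th factor as an indicator, so that the
        sum over the fiber becomes a sum of products over the whole space.\<close>
    define f where "f k b = M k (restrict x (S k)) b * (if k = j \<and> b \<noteq> v then 0 else 1)" for k b
    have xY: "x \<in> PiE {1..d} X" and xu: "restrict x (S j) = u" using x by (auto simp: fiber_def)
    have "(\<Sum>y\<in>fiber d X (S j) v. tensor m S M x y)
        = (\<Sum>y\<in>PiE {1..d} X. if restrict y (S j) = v then tensor m S M x y else 0)"
      unfolding fiber_def using finY by (simp add: sum.inter_filter)
    also have "\<dots> = (\<Sum>y\<in>PiE (\<Union>k\<in>{1..m}. S k) X. \<Prod>k=1..m. f k (restrict y (S k)))"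
      unfolding un
    proof (intro sum.cong refl)
      fix y
      show "(if restrict y (S j) = v then tensor m S M x y else 0)
          = (\<Prod>k=1..m. f k (restrict y (S k)))"
      proof (cases "restrict y (S j) = v")
        case True
        then show ?thesis unfolding tensor_def f_def by (auto intro!: prod.cong)
      next
        case False
        then have "f j (restrict y (S j)) = 0" by (simp add: f_def)
        then have "(\<Prod>k=1..m. f k (restrict y (S k))) = 0"
          using j by (intro prod_zero) auto
        then show ?thesis using False by simp
      qed
    qed
    also have "\<dots> = (\<Prod>k=1..m. \<Sum>b\<in>PiE (S k) X. f k b)"
      using disj fin by (intro sum_prod_blocks) auto
    also have "\<dots> = (\<Sum>b\<in>PiE (S j) X. f j b) * (\<Prod>k\<in>{1..m} - {j}. \<Sum>b\<in>PiE (S k) X. f k b)"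
      using j by (intro prod.remove) auto
    also have "(\<Prod>k\<in>{1..m} - {j}. \<Sum>b\<in>PiE (S k) X. f k b) = 1"
    proof (intro prod.neutral ballI)
      fix k assume k: "k \<in> {1..m} - {j}"
      then have "restrict x (S k) \<in> PiE (S k) X" using xY un by (auto simp: PiE_iff)
      then show "(\<Sum>b\<in>PiE (S k) X. f k b) = 1"
        using M[of k] k by (auto simp: f_def transition_matrices_def)
    qed
    also have "(\<Sum>b\<in>PiE (S j) X. f j b) = (\<Sum>b\<in>PiE (S j) X. if b = v then M j u b else 0)"
      by (intro sum.cong refl) (auto simp: f_def xu)
    also have "\<dots> = M j u v" using v fin[OF j] by simp
    finally show ?thesis by simp
  qed
  have "marginal d X \<pi> (S j) u * keep_in d X \<pi> (S j) (tensor m S M) u v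
      = (\<Sum>x\<in>fiber d X (S j) u. \<pi> x * (\<Sum>y\<in>fiber d X (S j) v. tensor m S M x y))"
    by (simp add: marginal_mult_keep_in[OF finY \<pi> T u] sum_distrib_left)
  also have "\<dots> = marginal d X \<pi> (S j) u * M j u v"
    by (simp add: row marginal_def sum_distrib_right)
  finally show ?thesis using marginal_pos[OF finY \<pi> T u] by simp
qed

lemma tensor_factorizable:
  assumes finY: "finite (PiE {1..d} X)" and \<pi>: "\<pi> \<in> positive_mass_functions (PiE {1..d} X)"
    and disj: "disjoint_family_on S {1..m}" and un: "(\<Union>j\<in>{1..m}. S j) = {1..d}"
    and fin: "\<And>j. j \<in> {1..m} \<Longrightarrow> finite (PiE (S j) X)"
    and M: "\<And>j. j \<in> {1..m} \<Longrightarrow> M j \<in> transition_matrices (PiE (S j) X)"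
  shows "tensor m S M \<in> factorizable d X \<pi> m S"
proof -
  have "tensor m S M x y = tensor m S (\<lambda>j. keep_in d X \<pi> (S j) (tensor m S M)) x y"
    if "x \<in> PiE {1..d} X" "y \<in> PiE {1..d} X" for x y
    unfolding tensor_def[of m S M x y] tensor_def[of m S "\<lambda>j. keep_in d X \<pi> (S j) (tensor m S M)"]
  proof (intro prod.cong refl)
    fix j assume j: "j \<in> {1..m}"
    have "restrict x (S j) \<in> PiE (S j) X" "restrict y (S j) \<in> PiE (S j) X"
      using that un j by (auto simp: PiE_iff)
    then show "M j (restrict x (S j)) (restrict y (S j))
        = keep_in d X \<pi> (S j) (tensor m S M) (restrict x (S j)) (restrict y (S j))"
      using keep_in_tensor[OF assms j] by simp
  qed
  then show ?thesis
    using tensor_transition_matrix[OF disj un fin M] by (auto simp: factorizable_def)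
qed

section \<open>The Pythagorean identity\<close>

theorem lemma2p1:
  fixes d n m :: nat
    and X :: "nat \<Rightarrow> 'a set"
    and w :: "nat \<Rightarrow> real"
    and \<pi> :: "(nat \<Rightarrow> 'a) \<Rightarrow> real"
    and P :: "nat \<Rightarrow> (nat \<Rightarrow> 'a) \<Rightarrow> (nat \<Rightarrow> 'a) \<Rightarrow> real"
    and S :: "nat \<Rightarrow> nat set"
  assumes finite_X: "\<And>i. i \<in> {1..d} \<Longrightarrow> finite (X i)"
    and w: "w \<in> weights n"
    and \<pi>: "\<pi> \<in> positive_mass_functions (PiE {1..d} X)"
    and P: "\<And>i. i \<in> {1..n} \<Longrightarrow> P i \<in> transition_matrices (PiE {1..d} X)"
    and P_stationary: "\<And>i. i \<in> {1..n} \<Longrightarrow> stationary (PiE {1..d} X) \<pi> (P i)"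
    and S_disjoint: "disjoint_family_on S {1..m}"
    and S_union: "(\<Union>j\<in>{1..m}. S j) = {1..d}"
  shows "(\<forall>Q \<in> transition_matrices (PiE {1..d} X).
            (\<Sum>i=1..n. ereal (w i) *
               KL (PiE {1..d} X) \<pi> (P i) (tensor m S (\<lambda>j. keep_in d X \<pi> (S j) Q)))
          = (\<Sum>i=1..n. ereal (w i) *
               KL (PiE {1..d} X) \<pi> (P i)
                 (tensor m S (\<lambda>j. keep_in d X \<pi> (S j) (weighted_mean n w P))))
            + (\<Sum>j=1..m. KL (PiE (S j) X) (marginal d X \<pi> (S j))
                 (keep_in d X \<pi> (S j) (weighted_mean n w P)) (keep_in d X \<pi> (S j) Q)))
       \<and> is_minimum_over
           (\<lambda>Q. \<Sum>i=1..n. ereal (w i) * KL (PiE {1..d} X) \<pi> (P i) Q)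
           (factorizable d X \<pi> m S)
           (\<Sum>i=1..n. ereal (w i) *
              KL (PiE {1..d} X) \<pi> (P i)
                (tensor m S (\<lambda>j. keep_in d X \<pi> (S j) (weighted_mean n w P))))"
proof -
  let ?Y = "PiE {1..d} X" and ?Pbar = "weighted_mean n w P"
  have sub: "S j \<subseteq> {1..d}" if "j \<in> {1..m}" for j using S_union that by auto
  have finY: "finite ?Y" using finite_X by (intro finite_PiE) auto
  have finS: "finite (PiE (S j) X)" if "j \<in> {1..m}" for j
    using finite_X sub[OF that] by (intro finite_PiE) (auto intro: finite_subset)
  have Pbar: "?Pbar \<in> transition_matrices ?Y"
    using weighted_mean_transition_matrix[OF w P] .
  have keep: "keep_in d X \<pi> (S j) Q \<in> transition_matrices (PiE (S j) X)"
    if "j \<in> {1..m}" "Q \<in> transition_matrices ?Y" for j Q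
    using keep_in_transition_matrix[OF finY \<pi> sub finS] that by blast
  have res: "restrict x (S j) \<in> PiE (S j) X" if "x \<in> ?Y" "j \<in> {1..m}" for x j
    using that sub by (auto simp: PiE_iff)
  let ?F = "\<lambda>Q. \<Sum>i=1..n. ereal (w i) * KL ?Y \<pi> (P i) Q"
  let ?T = "\<lambda>Q. tensor m S (\<lambda>j. keep_in d X \<pi> (S j) Q)"
  let ?G = "\<lambda>Q. \<Sum>j=1..m. KL (PiE (S j) X) (marginal d X \<pi> (S j))
                 (keep_in d X \<pi> (S j) ?Pbar) (keep_in d X \<pi> (S j) Q)"
  have pythagoras: "?F (?T Q) = ?F (?T ?Pbar) + ?G Q" if Q: "Q \<in> transition_matrices ?Y" for Q
  proof -
    have "?F (?T Q) = ?F (?T ?Pbar) + (\<Sum>j=1..m. \<Sum>x\<in>?Y. \<Sum>y\<in>?Y. ereal (\<pi> x * ?Pbar x y) *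
              log_ratio (keep_in d X \<pi> (S j) ?Pbar (restrict x (S j)) (restrict y (S j)))
                        (keep_in d X \<pi> (S j) Q (restrict x (S j)) (restrict y (S j))))"
    proof (rule weighted_KL_tensor_chain[OF w _ P])
      show "0 \<le> \<pi> x" if "x \<in> ?Y" for x
        using \<pi> that by (auto simp: positive_mass_functions_def intro: less_imp_le)
      show "0 \<le> keep_in d X \<pi> (S j) Q (restrict x (S j)) (restrict y (S j))"
        if "j \<in> {1..m}" "x \<in> ?Y" "y \<in> ?Y" for j x y
        using keep[OF _ Q] res that by (auto simp: transition_matrices_def)
      show "0 < keep_in d X \<pi> (S j) ?Pbar (restrict x (S j)) (restrict y (S j))"
        if "j \<in> {1..m}" "x \<in> ?Y" "y \<in> ?Y" "?Pbar x y \<noteq> 0" for j x y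
        using keep_in_restrict_pos[OF finY \<pi> sub Pbar] that by blast
    qed
    also have "\<dots> = ?F (?T ?Pbar) + ?G Q"
      using KL_keep_in_eq_sum[OF finY \<pi> sub finS Pbar] by simp
    finally show ?thesis .
  qed
  have "is_minimum_over ?F (factorizable d X \<pi> m S) (?F (?T ?Pbar))"
    unfolding is_minimum_over_def
  proof (intro conjI ballI)
    have "?T ?Pbar \<in> factorizable d X \<pi> m S"
      by (rule tensor_factorizable[OF finY \<pi> S_disjoint S_union finS keep[OF _ Pbar]])
    then show "\<exists>Q\<in>factorizable d X \<pi> m S. ?F Q = ?F (?T ?Pbar)"
      by (rule bexI[rotated]) (rule refl)
  next
    fix Q assume "Q \<in> factorizable d X \<pi> m S"
    then have Q: "Q \<in> transition_matrices ?Y"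
      and fac: "\<And>x y. x \<in> ?Y \<Longrightarrow> y \<in> ?Y \<Longrightarrow> Q x y = ?T Q x y"
      by (auto simp: factorizable_def)
    have "0 \<le> ?G Q"
      using marginal_pos[OF finY \<pi> sub]
      by (intro sum_nonneg KL_nonneg keep Pbar Q) (auto intro: less_imp_le)
    then have "?F (?T ?Pbar) \<le> ?F (?T Q)"
      unfolding pythagoras[OF Q] by (simp add: ereal_le_add_self)
    also have "\<dots> = ?F Q" using fac by (simp add: KL_def)
    finally show "?F (?T ?Pbar) \<le> ?F Q" .
  qed
  with pythagoras show ?thesis by (intro conjI ballI)
qed

end
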